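(* Let $d \ge 2$ be an integer, let $P$ be a partition of $[d]$, and let $R$ be a non-empty family of partitions of $[d]$. If $P$ is not finer than any of the partitions in $R$, then for every field $\mathbb{F}$ and every positive integer $n$ the order-$d$ tensor $\Delta_P : [n]^d \to \mathbb{F}$ has $R$-rank at least $n^{c(d)}$, where $c(d) = 3^{-2^{d+1}}$.
   Context: $[d]=\{1,\dots,d\}$; the parts of a partition are non-empty. $\mathbb{F}$ is an arbitrary field. For positive integers $n_1,\dots,n_d$, an order-$d$ tensor is a function $T:[n_1]\times\dots\times[n_d]\to\mathbb{F}$. For $x\in[n_1]\times\dots\times[n_d]$ and $J\subset[d]$, $x(J)\in\prod_{j\in J}[n_j]$ denotes the restriction of $x$ to its coordinates in $J$. $R$-rank: let $R$ be a non-empty family of partitions of $[d]$. An order-$d$ tensor $T$ has $R$-rank at most $1$ if there exist a partition $P\in R$ and, for each $J\in P$, a function $a_J:\prod_{j\in J}[n_j]\to\mathbb{F}$ such that $T(x)=\prod_{J\in P}a_J(x(J))$ for all $x$. The $R$-rank of $T$ is the smallest nonnegative integer $k$ such that $T=T_1+\dots+T_k$ for some order-$d$ tensors $T_1,\dots,T_k$ each of $R$-rank at most $1$ (the partition used may differ from one $T_i$ to another; the zero tensor has $R$-rank $0$). Finer: for partitions $P_1,P_2$ of $[d]$, $P_2$ is finer than $P_1$ (written $P_2\prec P_1$) if for every $J_2\in P_2$ there is $J_1\in P_1$ with $J_2\subset J_1$ (so every partition is finer than itself). The tensor $\Delta_P$: for non-empty $J\subset[d]$, $\Delta_J:[n]^J\to\mathbb{F}$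 is defined by $\Delta_J(x(J))=1$ if $x_{j_1}=x_{j_2}$ for all $j_1,j_2\in J$, and $\Delta_J(x(J))=0$ otherwise (so $\Delta_J\equiv 1$ if $|J|=1$). For a partition $P$ of $[d]$, $\Delta_P:[n]^d\to\mathbb{F}$ is $\Delta_P(x_1,\dots,x_d)=\prod_{J\in P}\Delta_J(x(J))$. *)

theory Defs
  imports Complex_Main "HOL-Library.Disjoint_Sets" "HOL-Library.FuncSet"
begin

text \<open>
  A point of \<open>[n\<^sub>1] \<times> \<dots> \<times> [n\<^sub>d]\<close> is an extensional function on \<open>{1..d}\<close>. An order-\<open>d\<close> tensor is
  represented by a function on all of \<open>nat \<Rightarrow> nat\<close>, of which only the values on the box matter:
  everything below compares tensors on the box only. The restriction \<open>x(J)\<close> is \<open>restrict x J\<close>.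
\<close>

definition index_box :: "nat \<Rightarrow> (nat \<Rightarrow> nat) \<Rightarrow> (nat \<Rightarrow> nat) set" where
  "index_box d N = (\<Pi>\<^sub>E j\<in>{1..d}. {1..N j})"

definition R_rank_at_most_1 ::
  "nat \<Rightarrow> (nat \<Rightarrow> nat) \<Rightarrow> nat set set set \<Rightarrow> ((nat \<Rightarrow> nat) \<Rightarrow> 'f::field) \<Rightarrow> bool" where
  "R_rank_at_most_1 d N R T \<longleftrightarrow>
     (\<exists>P\<in>R. \<exists>a :: nat set \<Rightarrow> (nat \<Rightarrow> nat) \<Rightarrow> 'f.
        \<forall>x\<in>index_box d N. T x = (\<Prod>J\<in>P. a J (restrict x J)))"

definition R_decomposition ::
  "nat \<Rightarrow> (nat \<Rightarrow> nat) \<Rightarrow> nat set set set \<Rightarrow> ((nat \<Rightarrow> nat) \<Rightarrow> 'f::field) \<Rightarrow> nat \<Rightarrow> bool" where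
  "R_decomposition d N R T k \<longleftrightarrow>
     (\<exists>S :: nat \<Rightarrow> (nat \<Rightarrow> nat) \<Rightarrow> 'f.
        (\<forall>i<k. R_rank_at_most_1 d N R (S i)) \<and>
        (\<forall>x\<in>index_box d N. T x = (\<Sum>i<k. S i x)))"

definition R_rank ::
  "nat \<Rightarrow> (nat \<Rightarrow> nat) \<Rightarrow> nat set set set \<Rightarrow> ((nat \<Rightarrow> nat) \<Rightarrow> 'f::field) \<Rightarrow> nat" where
  "R_rank d N R T = (LEAST k. R_decomposition d N R T k)"

definition Delta_block :: "nat set \<Rightarrow> (nat \<Rightarrow> nat) \<Rightarrow> 'f::field" where
  "Delta_block J y = (if \<forall>j1\<in>J. \<forall>j2\<in>J. y j1 = y j2 then 1 else 0)"

definition Delta :: "nat set set \<Rightarrow> (nat \<Rightarrow> nat) \<Rightarrow> 'f::field" where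
  "Delta P x = (\<Prod>J\<in>P. Delta_block J (restrict x J))"

text \<open>The minimum in \<open>R_rank\<close> is attained: every tensor is a sum of multiples of point indicators.\<close>

lemma R_decomposition_exists:
  fixes T :: "(nat \<Rightarrow> nat) \<Rightarrow> 'f::field"
  assumes "d \<ge> 1" "R \<noteq> {}" and R: "\<And>Q. Q \<in> R \<Longrightarrow> partition_on {1..d} Q"
  shows "\<exists>k. R_decomposition d N R T k"
proof -
  obtain P where P: "P \<in> R" "partition_on {1..d} P"
    using assms by blast
  then obtain J0 where J0: "J0 \<in> P"
    using \<open>d \<ge> 1\<close> by (fastforce simp: partition_on_def)
  have fP: "finite P"
    using P(2) by (meson finite_atLeastAtMost finite_elements)
  have fB: "finite (index_box d N)"
    unfolding index_box_def by (intro finite_PiE) auto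
  then obtain h where h: "bij_betw h {..<card (index_box d N)} (index_box d N)"
    using ex_bij_betw_nat_finite by (metis atLeast0LessThan)
  define S :: "nat \<Rightarrow> (nat \<Rightarrow> nat) \<Rightarrow> 'f"
    where "S i x = (if x = h i then T x else 0)" for i x
  have eq: "x = y" if "x \<in> index_box d N" "y \<in> index_box d N" "\<forall>J\<in>P. restrict x J = restrict y J" for x y
  proof (rule PiE_ext)
    show "x \<in> (\<Pi>\<^sub>E j\<in>{1..d}. {1..N j})" "y \<in> (\<Pi>\<^sub>E j\<in>{1..d}. {1..N j})"
      using that by (simp_all add: index_box_def)
    fix j assume "j \<in> {1..d}"
    then obtain J where J: "J \<in> P" "j \<in> J"
      using partition_onD1[OF P(2)] by blast
    have "restrict x J j = restrict y J j"
      using that(3) J by simp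
    then show "x j = y j" using J by simp
  qed
  have one: "R_rank_at_most_1 d N R (S i)" if i: "i < card (index_box d N)" for i
  proof -
    have hi: "h i \<in> index_box d N"
      using h i by (auto simp: bij_betw_def)
    define a :: "nat set \<Rightarrow> (nat \<Rightarrow> nat) \<Rightarrow> 'f" where
      "a J y = (if y = restrict (h i) J then if J = J0 then T (h i) else 1 else 0)" for J y
    have "S i x = (\<Prod>J\<in>P. a J (restrict x J))" if x: "x \<in> index_box d N" for x
    proof (cases "x = h i")
      case True
      have "(\<Prod>J\<in>P. a J (restrict x J)) = (\<Prod>J\<in>P. if J = J0 then T (h i) else 1)"
        by (rule prod.cong) (auto simp: a_def True)
      also have "\<dots> = T (h i)"
        using fP J0 by simp
      finally show ?thesis by (simp add: S_def True)
    next
      case False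
      then obtain J where "J \<in> P" "restrict x J \<noteq> restrict (h i) J"
        using eq[OF x hi] by blast
      then have "(\<Prod>J\<in>P. a J (restrict x J)) = 0"
        using fP by (intro prod_zero) (auto simp: a_def)
      then show ?thesis using False by (simp add: S_def)
    qed
    then show ?thesis
      unfolding R_rank_at_most_1_def using P(1) by blast
  qed
  have "T x = (\<Sum>i<card (index_box d N). S i x)" if x: "x \<in> index_box d N" for x
  proof -
    have "(\<Sum>i<card (index_box d N). S i x) = (\<Sum>y\<in>index_box d N. if x = y then T x else 0)"
      unfolding S_def by (rule sum.reindex_bij_betw[OF h])
    also have "\<dots> = T x" using fB x by simp
    finally show ?thesis by simp
  qed
  then show ?thesis
    unfolding R_decomposition_def using one by blast
qed

end

theory Submission
  imports Defs
begin

text \<open>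
  Every summand of a decomposition of \<open>\<Delta>\<^sub>P\<close> is a product \<open>f(x(I)) g(x(I\<^sup>c))\<close> in which \<open>I\<close> splits some block of
  \<open>P\<close>. For a single block \<open>J\<close>, fewer than \<open>|X|\<close> split products on \<open>X\<^sup>J\<close> can be annihilated by a linear
  functional that does not vanish on the diagonal tensor: contract one coordinate against a vector
  of large support that is orthogonal to all summands splitting off exactly that coordinate.
  For general \<open>P\<close> the blocks are removed one at a time. The coordinates outside \<open>J\<close> are first confined
  to a set \<open>A'\<close> so small that all slices in the direction \<open>J\<close>, of all summands splitting \<open>J\<close>, number
  fewer than \<open>|A|\<close>; one functional then kills them all, while the remaining summands stay products
  that split another block. Since the side length only drops polynomially at each step, \<open>k\<close>
  summands force \<open>n < (k + 1) ^ (d + 1) ^ |P|\<close>. The case \<open>k = 1\<close>, where this is too weak for small \<open>n\<close>, is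
  handled directly.
\<close>

section \<open>Homogeneous linear systems with few equations\<close>

text \<open>Gaussian elimination: an equation \<open>s0\<close> with a nonzero coefficient at
  \<open>x0\<close> is used to remove one equation and one unknown.\<close>

lemma underdetermined_system:
  fixes a :: "'s \<Rightarrow> 'b \<Rightarrow> 'f::field"
  assumes "finite S" "finite X" "card S < card X"
  shows "\<exists>u. (\<exists>x\<in>X. u x \<noteq> 0) \<and> (\<forall>s\<in>S. (\<Sum>x\<in>X. u x * a s x) = 0)"
  using assms
proof (induction S arbitrary: X a rule: finite_induct)
  case empty
  then obtain x where "x \<in> X" by fastforce
  then show ?case by (intro exI[of _ "\<lambda>_. 1"]) auto
next
  case (insert s0 S)
  show ?case
  proof (cases "\<forall>x\<in>X. a s0 x = 0")
    case True
    obtain u where "\<exists>x\<in>X. u x \<noteq> 0" "\<forall>s\<in>S. (\<Sum>x\<in>X. u x * a s x) = 0"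
      using insert.IH[of X a] insert.prems insert.hyps by auto
    then show ?thesis using True by (intro exI[of _ u]) auto
  next
    case False
    then obtain x0 where x0: "x0 \<in> X" "a s0 x0 \<noteq> 0" by blast
    \<comment> \<open>Equation \<open>s\<close> after the unknown \<open>x0\<close> has been
      eliminated by means of \<open>s0\<close>.\<close>
    define b where "b s x = a s x - a s x0 / a s0 x0 * a s0 x" for s x
    have "card S < card (X - {x0})"
      using insert x0 by simp
    then obtain u x1 where u: "x1 \<in> X - {x0}" "u x1 \<noteq> 0"
        "\<forall>s\<in>S. (\<Sum>x\<in>X-{x0}. u x * b s x) = 0"
      using insert.IH[of "X - {x0}" b] insert.prems by auto
    define c where "c = (\<Sum>x\<in>X-{x0}. u x * a s0 x)"
    \<comment> \<open>The value at \<open>x0\<close> is the one forced by equation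
      \<open>s0\<close>.\<close>
    define w where "w = u(x0 := - c / a s0 x0)"
    have w: "(\<Sum>x\<in>X. w x * a s x) = (\<Sum>x\<in>X-{x0}. u x * a s x) - c / a s0 x0 * a s x0" for s
    proof -
      have "(\<Sum>x\<in>X-{x0}. w x * a s x) = (\<Sum>x\<in>X-{x0}. u x * a s x)"
        by (rule sum.cong) (auto simp: w_def)
      then show ?thesis
        using insert.prems x0 by (simp add: sum.remove[of X x0] w_def)
    qed
    have "(\<Sum>x\<in>X. w x * a s x) = 0" if "s \<in> S" for s
    proof -
      have "0 = (\<Sum>x\<in>X-{x0}. u x * a s x - a s x0 / a s0 x0 * (u x * a s0 x))"
        using u(3)[rule_format, OF that]
          by (simp add: b_def right_diff_distrib mult.left_commute)
      also have "\<dots> = (\<Sum>x\<in>X-{x0}. u x * a s x) - a s x0 / a s0 x0 * c"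
        by (simp add: sum_subtractf c_def sum_distrib_left)
      finally show ?thesis by (simp add: w)
    qed
    moreover have "(\<Sum>x\<in>X. w x * a s0 x) = 0"
      using x0 by (simp add: w c_def)
    moreover have "w x1 \<noteq> 0" "x1 \<in> X" using u by (auto simp: w_def)
    ultimately show ?thesis by (intro exI[of _ w]) auto
  qed
qed

text \<open>While the support \<open>U\<close> has fewer than \<open>card X - card S\<close> points,
  the system restricted to \<open>X - U\<close> is underdetermined. Adding a nonzero solution that
  lives on \<open>X - U\<close> enlarges the support without cancellation.\<close>

lemma orthogonal_large_support:
  fixes a :: "'s \<Rightarrow> 'b \<Rightarrow> 'f::field"
  assumes fin: "finite S" "finite X"
  shows "\<exists>u. (\<forall>s\<in>S. (\<Sum>x\<in>X. u x * a s x) = 0) \<and> card X \<le> card {x\<in>X. u x \<noteq> 0} + card S"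
proof -
  have "\<exists>u. (\<forall>s\<in>S. (\<Sum>x\<in>X. u x * a s x) = 0) \<and> m \<le> card {x\<in>X. u x \<noteq> 0}"
    if "m + card S \<le> card X" for m
    using that
  proof (induction m)
    case 0
    show ?case by (intro exI[of _ "\<lambda>_. 0"]) auto
  next
    case (Suc m)
    then obtain u where u: "\<And>s. s \<in> S \<Longrightarrow> (\<Sum>x\<in>X. u x * a s x) = 0"
        "m \<le> card {x\<in>X. u x \<noteq> 0}"
      by auto
    define U where "U = {x\<in>X. u x \<noteq> 0}"
    have U: "U \<subseteq> X" "finite U" using fin by (auto simp: U_def)
    show ?case
    proof (cases "card U = m")
      case False
      then show ?thesis using u by (intro exI[of _ u]) (auto simp: U_def)
    next
      case True
      then have "card S < card (X - U)"
        using Suc.prems U fin by (simp add: card_Diff_subset)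
      then obtain v x1 where v: "x1 \<in> X - U" "v x1 \<noteq> 0"
          "\<forall>s\<in>S. (\<Sum>x\<in>X-U. v x * a s x) = 0"
        using underdetermined_system[of S "X - U" a] fin by auto
      define w where "w x = (if x \<in> U then u x else v x)" for x
      have "(\<Sum>x\<in>X. w x * a s x) = 0" if "s \<in> S" for s
      proof -
        have "(\<Sum>x\<in>X. w x * a s x) = (\<Sum>x\<in>X-U. w x * a s x) + (\<Sum>x\<in>U. w x * a s x)"
          using U fin by (intro sum.subset_diff) auto
        also have "(\<Sum>x\<in>X-U. w x * a s x) = (\<Sum>x\<in>X-U. v x * a s x)"
          by (rule sum.cong) (auto simp: w_def)
        also have "(\<Sum>x\<in>U. w x * a s x) = (\<Sum>x\<in>X. u x * a s x)"
          using fin by (intro sum.mono_neutral_cong_left) (auto simp: w_def U_def)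
        finally show ?thesis using u v that by simp
      qed
      moreover have "Suc m \<le> card {x\<in>X. w x \<noteq> 0}"
      proof -
        have "insert x1 U \<subseteq> {x\<in>X. w x \<noteq> 0}"
          using v U by (auto simp: w_def) (auto simp: U_def)
        then have "card (insert x1 U) \<le> card {x\<in>X. w x \<noteq> 0}"
          using fin by (intro card_mono) auto
        then show ?thesis using v U True by simp
      qed
      ultimately show ?thesis by blast
    qed
  qed
  from this[of "card X - card S"] show ?thesis
    by (cases "card S \<le> card X") (force intro: exI[of _ "\<lambda>_. 0"])+
qed

section \<open>Split products and linear functionals on boxes\<close>

definition depends_on :: "(('i \<Rightarrow> 'b) \<Rightarrow> 'f) \<Rightarrow> 'i set \<Rightarrow> bool" where
  "depends_on f I \<longleftrightarrow> (\<forall>x y. (\<forall>i\<in>I. x i = y i) \<longrightarrow> f x = f y)"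

lemma depends_onD: "depends_on f I \<Longrightarrow> (\<And>i. i \<in> I \<Longrightarrow> x i = y i) \<Longrightarrow> f x = f y"
  unfolding depends_on_def by blast

text \<open>\<open>D\<close> holds the coordinates still present, and the bipartition into
  \<open>I\<close> and \<open>D - I\<close> cuts the block \<open>J\<close>. Two factors suffice,
  because the factors of a finer product can be grouped.\<close>

definition split_product :: "'i set \<Rightarrow> 'i set \<Rightarrow> (('i \<Rightarrow> 'b) \<Rightarrow> 'f::field) \<Rightarrow> bool" where
  "split_product D J T \<longleftrightarrow>
     (\<exists>I f g. I \<subseteq> D \<and> J \<inter> I \<noteq> {} \<and> J - I \<noteq> {} \<and> depends_on f I \<and> depends_on g (D - I) \<and>
        T = (\<lambda>x. f x * g x))"

text \<open>\<open>I\<close> and \<open>D - I\<close> play symmetric roles, so the side containing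
  \<open>j\<close> may be called \<open>I\<close>.\<close>

lemma split_productE:
  assumes "split_product D J T" "J \<subseteq> D" "j \<in> D"
  obtains I f g where "I \<subseteq> D" "j \<in> I" "J \<inter> I \<noteq> {}" "J - I \<noteq> {}"
    "depends_on f I" "depends_on g (D - I)" "T = (\<lambda>x. f x * g x)"
proof -
  obtain I f g where *: "I \<subseteq> D" "J \<inter> I \<noteq> {}" "J - I \<noteq> {}"
    "depends_on f I" "depends_on g (D - I)" "T = (\<lambda>x. f x * g x)"
    using assms(1) unfolding split_product_def by blast
  show thesis
  proof (cases "j \<in> I")
    case True
    with * that show ?thesis by blast
  next
    case False
    have eq: "D - (D - I) = I" using *(1) by blast
    show ?thesis
      by (rule that[of "D - I" g f]) (use * False assms eq in \<open>auto simp: mult.commute\<close>)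
  qed
qed

lemma split_product_depends_on: "split_product D J T \<Longrightarrow> depends_on T D"
  unfolding split_product_def depends_on_def by (elim exE conjE) (simp, metis subsetD DiffD1)

text \<open>The dual of the space of tensors on the box \<open>X^J\<close>, described by linearity
  and locality rather than by coefficients, so that the inductions carry no coefficient
  array.\<close>

definition box_functional :: "'b set \<Rightarrow> 'i set \<Rightarrow> ((('i \<Rightarrow> 'b) \<Rightarrow> 'f::field) \<Rightarrow> 'f) \<Rightarrow> bool" where
  "box_functional X J \<phi> \<longleftrightarrow>
     (\<forall>a b. \<phi> (\<lambda>x. a x + b x) = \<phi> a + \<phi> b) \<and> (\<forall>c a. \<phi> (\<lambda>x. c * a x) = c * \<phi> a) \<and>
     (\<forall>a b. (\<forall>x. (\<forall>i\<in>J. x i \<in> X) \<longrightarrow> a x = b x) \<longrightarrow> \<phi> a = \<phi> b)"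

lemma box_functional_cong:
  "box_functional X J \<phi> \<Longrightarrow> (\<And>x. \<forall>i\<in>J. x i \<in> X \<Longrightarrow> a x = b x) \<Longrightarrow> \<phi> a = \<phi> b"
  unfolding box_functional_def by blast

lemma box_functional_scale: "box_functional X J \<phi> \<Longrightarrow> \<phi> (\<lambda>x. c * a x) = c * \<phi> a"
  unfolding box_functional_def by blast

lemma box_functional_sum:
  assumes "box_functional X J \<phi>"
  shows "\<phi> (\<lambda>x. \<Sum>s\<in>S. a s x) = (\<Sum>s\<in>S. \<phi> (a s))"
proof (induction S rule: infinite_finite_induct)
  case (insert s S)
  then show ?case using assms unfolding box_functional_def by simp
qed (use box_functional_scale[OF assms, of 0] in auto)

text \<open>The weights \<open>w\<close> are needed because contracting a coordinate multiplies them by a vector.\<close>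

definition diagonal :: "'i set \<Rightarrow> ('b \<Rightarrow> 'f) \<Rightarrow> ('i \<Rightarrow> 'b) \<Rightarrow> 'f::field" where
  "diagonal J w x = (if \<forall>i\<in>J. \<forall>i'\<in>J. x i = x i' then w (x (SOME i. i \<in> J)) else 0)"

text \<open>The choice in \<open>diagonal\<close> is immaterial: wherever the weight is used, all
  coordinates in \<open>J\<close> agree.\<close>

lemma diagonal_eq: "i \<in> J \<Longrightarrow> diagonal J w x = (if \<forall>i'\<in>J. x i' = x i then w (x i) else 0)"
  unfolding diagonal_def by (smt (verit, best) someI)

section \<open>Annihilating split products on a single block\<close>

text \<open>As \<open>J\<close> contains \<open>i0\<close>, only the summand with
  \<open>v = y i0\<close> can be nonzero.\<close>

lemma contract_diagonal:
  assumes "finite X" "j \<notin> J" "i0 \<in> J" "\<forall>i\<in>J. y i \<in> X"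
  shows "(\<Sum>v\<in>X. u v * diagonal (insert j J) w (y(j := v))) = diagonal J (\<lambda>v. u v * w v) y"
proof -
  have eq: "u v * diagonal (insert j J) w (y(j := v)) =
      (if v = y i0 then diagonal J (\<lambda>v. u v * w v) y else 0)" for v
  proof -
    have "diagonal (insert j J) w (y(j := v)) = (if \<forall>i\<in>J. y i = v then w v else 0)"
      unfolding diagonal_eq[of j "insert j J", OF insertI1] using assms(2) by auto
    moreover have "(\<forall>i\<in>J. y i = v) \<longleftrightarrow> v = y i0 \<and> (\<forall>i\<in>J. y i = y i0)"
      using assms(3) by metis
    ultimately show ?thesis
      by (simp add: diagonal_eq[OF assms(3)])
  qed
  show ?thesis unfolding eq using assms by simp
qed

text \<open>Let \<open>I\<close> be the side containing \<open>j\<close>. If it is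
  \<open>{j}\<close>, the first alternative holds. Otherwise the contraction acts on
  \<open>f\<close> alone, and \<open>I - {j}\<close> still cuts \<open>J\<close>.\<close>

lemma contract_split_product:
  fixes T :: "('i \<Rightarrow> 'b) \<Rightarrow> 'f::field"
  assumes T: "split_product (insert j J) (insert j J) T" and j: "j \<notin> J"
  shows "(\<exists>f g. depends_on f {j} \<and> depends_on g J \<and> T = (\<lambda>x. f x * g x)) \<or>
    split_product J J (\<lambda>y. \<Sum>v\<in>X. u v * T (y(j := v)))"
proof -
  obtain I f g where I: "I \<subseteq> insert j J" "j \<in> I" "insert j J - I \<noteq> {}"
    "depends_on f I" "depends_on g (insert j J - I)" and Teq: "T = (\<lambda>x. f x * g x)"
    by (rule split_productE[OF T subset_refl insertI1])
  have gdep: "depends_on g (J - (I - {j}))"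
    using I j by (metis Diff_insert_absorb Diff_insert2 insert_Diff insert_Diff_if)
  show ?thesis
  proof (cases "I = {j}")
    case True
    then have "J - (I - {j}) = J" using j by auto
    then show ?thesis using True I gdep Teq by auto
  next
    case False
    have "split_product J J (\<lambda>y. \<Sum>v\<in>X. u v * T (y(j := v)))"
    proof -
      define f' where "f' y = (\<Sum>v\<in>X. u v * f (y(j := v)))" for y
      have "depends_on f' (I - {j})"
        unfolding depends_on_def f'_def
        by (intro allI impI sum.cong refl arg_cong2[where f = "(*)"] depends_onD[OF I(4)]) auto
      moreover have "g (y(j := v)) = g y" for y v
        by (rule depends_onD[OF gdep]) (use j in auto)
      then have "(\<lambda>y. \<Sum>v\<in>X. u v * T (y(j := v))) = (\<lambda>y. f' y * g y)"
        by (simp add: Teq f'_def sum_distrib_right mult.assoc)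
      ultimately show ?thesis
        unfolding split_product_def using I gdep False j
        by (intro exI[of _ "I - {j}"] exI[of _ f'] exI[of _ g]) auto
    qed
    then show ?thesis ..
  qed
qed

text \<open>Induction on the block. Contracting against \<open>u\<close> disposes of the summands in
  \<open>S1\<close> and shrinks \<open>X\<close> to the support of \<open>u\<close>, a loss of at
  most \<open>card S1\<close> points, so the strict inequality persists. On that support the new
  weights \<open>u v * w v\<close> are again nonzero.\<close>

lemma annihilating_functional:
  fixes T :: "'s \<Rightarrow> ('i \<Rightarrow> 'b) \<Rightarrow> 'f::field"
  assumes "finite J" "J \<noteq> {}" "finite S" "finite X" "card S < card X"
    and "\<And>s. s \<in> S \<Longrightarrow> split_product J J (T s)" and "\<And>v. v \<in> X \<Longrightarrow> w v \<noteq> 0"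
  shows "\<exists>\<phi>. box_functional X J \<phi> \<and> (\<forall>s\<in>S. \<phi> (T s) = 0) \<and> \<phi> (diagonal J w) \<noteq> 0"
  using assms
proof (induction J arbitrary: S X T w rule: finite_ne_induct)
  case (singleton j)
  then obtain v where v: "v \<in> X" by fastforce
  \<comment> \<open>A one-element block cannot be cut, so evaluation at a single point will
    do.\<close>
  have "S = {}"
    using singleton.prems(4) unfolding split_product_def by blast
  then show ?case
    using v singleton.prems
    by (intro exI[of _ "\<lambda>a. a (\<lambda>_. v)"]) (auto simp: box_functional_def diagonal_def)
next
  case (insert j J)
  obtain i0 where i0: "i0 \<in> J" using insert by blast
  define S1 where "S1 = {s\<in>S. \<exists>f g. depends_on f {j} \<and> depends_on g J \<and> T s = (\<lambda>x. f x * g x)}"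
  have S1: "S1 \<subseteq> S" "finite S1" using insert.prems by (auto simp: S1_def)
  have "\<forall>s\<in>S1. \<exists>f g. depends_on f {j} \<and> depends_on g J \<and> T s = (\<lambda>x. f x * g x)"
    by (auto simp: S1_def)
  then obtain f g where fg: "\<And>s. s \<in> S1 \<Longrightarrow> depends_on (f s) {j}"
      "\<And>s. s \<in> S1 \<Longrightarrow> depends_on (g s) J" "\<And>s. s \<in> S1 \<Longrightarrow> T s = (\<lambda>x. f s x * g s x)"
    by metis
  obtain u where u: "\<forall>s\<in>S1. (\<Sum>v\<in>X. u v * f s (\<lambda>_. v)) = 0"
      "card X \<le> card {v\<in>X. u v \<noteq> 0} + card S1"
    using orthogonal_large_support[of S1 X "\<lambda>s v. f s (\<lambda>_. v)"] S1 insert.prems by auto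
  define Y where "Y = {v\<in>X. u v \<noteq> 0}"
  have Y: "Y \<subseteq> X" "finite Y" using insert.prems by (auto simp: Y_def)
  define C where "C a y = (\<Sum>v\<in>Y. u v * a (y(j := v)))" for a :: "('i \<Rightarrow> 'b) \<Rightarrow> 'f" and y
  have "card (S - S1) < card Y"
    using u(2) insert.prems(4) card_Diff_subset[OF S1(2,1)] card_mono[OF insert.prems(1) S1(1)]
      insert.prems(3) by (simp add: Y_def)
  moreover have "split_product J J (C (T s))" if "s \<in> S - S1" for s
  proof -
    have "C (T s) = (\<lambda>y. \<Sum>v\<in>Y. u v * T s (y(j := v)))"
      by (simp add: C_def[abs_def])
    then show ?thesis
      using contract_split_product[OF insert.prems(4) insert.hyps(3), of s u Y] that
      by (auto simp: S1_def fun_upd_def)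
  qed
  moreover have "u v * w v \<noteq> 0" if "v \<in> Y" for v
    using that insert.prems by (auto simp: Y_def)
  ultimately obtain \<phi> where \<phi>: "box_functional Y J \<phi>" "\<forall>s\<in>S-S1. \<phi> (C (T s)) = 0"
      "\<phi> (diagonal J (\<lambda>v. u v * w v)) \<noteq> 0"
    using insert.IH[of "S - S1" Y "\<lambda>s. C (T s)" "\<lambda>v. u v * w v"] insert.prems Y by auto
  have "C (\<lambda>x. a x + b x) = (\<lambda>y. C a y + C b y)" for a b
    by (auto simp: C_def algebra_simps sum.distrib)
  moreover have "C (\<lambda>x. c * a x) = (\<lambda>y. c * C a y)" for c a
    by (auto simp: C_def sum_distrib_left algebra_simps)
  moreover have "\<phi> (C a) = \<phi> (C b)" if "\<forall>x. (\<forall>i\<in>insert j J. x i \<in> X) \<longrightarrow> a x = b x" for a b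
  proof (rule box_functional_cong[OF \<phi>(1)], unfold C_def, rule sum.cong[OF refl])
    fix y v assume "\<forall>i\<in>J. y i \<in> Y" "v \<in> Y"
    then have "\<forall>i\<in>insert j J. (y(j := v)) i \<in> X" using Y(1) by auto
    then show "u v * a (y(j := v)) = u v * b (y(j := v))" using that by metis
  qed
  ultimately have "box_functional X (insert j J) (\<lambda>a. \<phi> (C a))"
    using \<phi>(1) by (simp add: box_functional_def)
  moreover have "\<phi> (C (T s)) = 0" if s: "s \<in> S" for s
  proof (cases "s \<in> S1")
    case True
    \<comment> \<open>The contraction leaves \<open>g s\<close> times the pairing of
      \<open>u\<close> with \<open>f s\<close>, which is zero by the choice of
      \<open>u\<close>.\<close>
    have "C (T s) = (\<lambda>y. 0)"
    proof
      fix y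
      have *: "f s (y(j := v)) = f s (\<lambda>_. v)" "g s (y(j := v)) = g s y" for v
        using depends_onD[OF fg(1)[OF True], of "y(j := v)" "\<lambda>_. v"]
          depends_onD[OF fg(2)[OF True], of "y(j := v)" y] insert.hyps by force+
      have "C (T s) y = (\<Sum>v\<in>Y. u v * f s (\<lambda>_. v)) * g s y"
        by (simp add: C_def fg(3)[OF True] * sum_distrib_right mult.assoc)
      also have "(\<Sum>v\<in>Y. u v * f s (\<lambda>_. v)) = (\<Sum>v\<in>X. u v * f s (\<lambda>_. v))"
        by (rule sum.mono_neutral_left) (use insert.prems in \<open>auto simp: Y_def\<close>)
      finally show "C (T s) y = 0" using u(1) True by simp
    qed
    then show ?thesis using box_functional_scale[OF \<phi>(1), of 0 "\<lambda>_. 0"] by simp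
  qed (use \<phi>(2) s in auto)
  moreover have "\<phi> (C (diagonal (insert j J) w)) = \<phi> (diagonal J (\<lambda>v. u v * w v))"
    by (rule box_functional_cong[OF \<phi>(1)])
       (unfold C_def, rule contract_diagonal[OF Y(2) _ i0], use insert.hyps in auto)
  ultimately show ?case using \<phi>(3) by (intro exI[of _ "\<lambda>a. \<phi> (C a)"]) auto
qed

section \<open>Removing the blocks one at a time\<close>

text \<open>Freezing the coordinates outside \<open>J\<close> leaves factors in
  \<open>J \<inter> I\<close> and \<open>J - I\<close>, both nonempty because \<open>I\<close> cuts
  \<open>J\<close>.\<close>

lemma split_product_slice:
  assumes T: "split_product (J \<union> D) J T" and "J \<inter> D = {}"
  shows "split_product J J (\<lambda>x. T (override_on z x J))"
proof -
  obtain I f g where I: "I \<subseteq> J \<union> D" "J \<inter> I \<noteq> {}" "J - I \<noteq> {}"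
    "depends_on f I" "depends_on g (J \<union> D - I)" and Teq: "T = (\<lambda>x. f x * g x)"
    using T unfolding split_product_def by blast
  have "depends_on (\<lambda>x. f (override_on z x J)) (J \<inter> I)"
    unfolding depends_on_def by (intro allI impI depends_onD[OF I(4)]) (auto simp: override_on_def)
  moreover have "depends_on (\<lambda>x. g (override_on z x J)) (J - J \<inter> I)"
    unfolding depends_on_def by (intro allI impI depends_onD[OF I(5)]) (auto simp: override_on_def)
  ultimately show ?thesis
    unfolding split_product_def using I Teq by (intro exI[of _ "J \<inter> I"]) auto
qed

text \<open>As \<open>J\<close> is not cut, it lies on one side \<open>I\<close>. The functional
  acts on \<open>f\<close> and treats \<open>g\<close> as a scalar; removing \<open>J\<close> from
  \<open>I\<close> does not affect how \<open>J'\<close> is cut.\<close>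

lemma split_product_apply_functional:
  assumes T: "split_product (J \<union> D) J' T" "\<not> split_product (J \<union> D) J T"
    and J: "J' \<subseteq> D" "J \<inter> D = {}" "j \<in> J" and \<phi>: "box_functional X J \<phi>"
  shows "split_product D J' (\<lambda>z. \<phi> (\<lambda>x. T (override_on z x J)))"
proof -
  obtain I f g where I: "I \<subseteq> J \<union> D" "j \<in> I" "J' \<inter> I \<noteq> {}" "J' - I \<noteq> {}"
    "depends_on f I" "depends_on g (J \<union> D - I)" and Teq: "T = (\<lambda>x. f x * g x)"
    by (rule split_productE[OF T(1), of j]) (use J in auto)
  have JI: "J \<subseteq> I"
    using T(2) I Teq J(3) unfolding split_product_def by blast
  have "depends_on (\<lambda>z. \<phi> (\<lambda>x. f (override_on z x J))) (I - J)"
    unfolding depends_on_def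
    by (intro allI impI arg_cong[where f = \<phi>] ext depends_onD[OF I(5)])
       (auto simp: override_on_def)
  moreover have "depends_on g (D - (I - J))"
  proof -
    have "J \<union> D - I = D - (I - J)" using JI J(2) by blast
    then show ?thesis using I(6) by simp
  qed
  moreover have "\<phi> (\<lambda>x. T (override_on z x J)) = \<phi> (\<lambda>x. f (override_on z x J)) * g z" for z
  proof -
    have "g (override_on z x J) = g z" for x
      by (rule depends_onD[OF I(6)]) (use JI in \<open>auto simp: override_on_def\<close>)
    then show ?thesis
      using box_functional_scale[OF \<phi>, of "g z" "\<lambda>x. f (override_on z x J)"]
      by (simp add: Teq mult.commute)
  qed
  ultimately show ?thesis
    unfolding split_product_def using I(1,3,4) J JI
    by (intro exI[of _ "I - J"] exI[of _ "\<lambda>z. \<phi> (\<lambda>x. f (override_on z x J))"] exI[of _ g]) auto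
qed

lemma Delta_insert_override_on:
  assumes "finite P" "J \<notin> P" "\<And>K. K \<in> P \<Longrightarrow> J \<inter> K = {}"
  shows "Delta (insert J P) (override_on z x J) = (Delta P z * diagonal J (\<lambda>_. 1) x :: 'f::field)"
proof -
  have "restrict (override_on z x J) K = restrict z K" if "K \<in> P" for K
    using assms(3)[OF that] by (auto simp: override_on_def restrict_def fun_eq_iff)
  then have "(\<Prod>K\<in>P. Delta_block K (restrict (override_on z x J) K)) = (Delta P z :: 'f)"
    by (simp add: Delta_def)
  moreover have "Delta_block J (restrict (override_on z x J) J) = (diagonal J (\<lambda>_. 1) x :: 'f)"
    by (auto simp: Delta_block_def diagonal_def)
  ultimately show ?thesis
    using assms(1,2) by (simp add: Delta_def)
qed

text \<open>Removing one block never increases the number of summands, so \<open>k\<close> stays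
  fixed, as does the bound \<open>d\<close> on the number of coordinates. Only the exponent changes,
  by a factor \<open>d + 1\<close> per block.\<close>

lemma Delta_neq_sum_split_products:
  fixes T :: "'s \<Rightarrow> (nat \<Rightarrow> nat) \<Rightarrow> 'f::field"
  assumes "finite P" "disjoint P" "\<And>J. J \<in> P \<Longrightarrow> finite J \<and> J \<noteq> {}" "card (\<Union>P) \<le> d"
    and "finite S" "card S \<le> k" "\<And>s. s \<in> S \<Longrightarrow> \<exists>J\<in>P. split_product (\<Union>P) J (T s)"
    and "finite A" "(k + 1) ^ ((d + 1) ^ card P) \<le> card A"
  shows "\<exists>x. (\<forall>i\<in>\<Union>P. x i \<in> A) \<and> Delta P x \<noteq> (\<Sum>s\<in>S. T s x)"
  using assms
proof (induction P arbitrary: S T A rule: finite_induct)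
  case empty
  \<comment> \<open>No block is left to be cut, and \<open>Delta {}\<close> is the empty product 1,
    while the sum is 0.\<close>
  then have "S = {}" by auto
  then show ?case by (simp add: Delta_def)
next
  case (insert J P)
  define D where "D = \<Union>P"
  define m where "m = (d + 1) ^ card P"
  have disj: "J \<inter> K = {}" if "K \<in> P" for K
    using insert.prems(1) insert.hyps(2) that by (auto simp: disjoint_def)
  have J: "finite J" "J \<noteq> {}" "J \<inter> D = {}"
    using insert.prems(2) disj by (auto simp: D_def)
  have D: "finite D" using insert.prems(2) insert.hyps(1) by (auto simp: D_def)
  have "card D \<le> card (J \<union> D)" using J D by (intro card_mono) auto
  then have card_D: "card D \<le> d" using insert.prems(3) by (simp add: D_def)
  \<comment> \<open>The exponents compare because \<open>m \<ge> 1\<close> gives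
    \<open>d * m + 1 \<le> (d + 1) * m\<close>.\<close>
  have "(k + 1) ^ (d * m + 1) \<le> (k + 1) ^ ((d + 1) ^ card (insert J P))"
    using insert.hyps by (intro power_increasing) (auto simp: m_def)
  then have card_A: "(k + 1) ^ (d * m + 1) \<le> card A"
    using insert.prems(8) by linarith
  have "(k + 1) ^ m \<le> (k + 1) ^ ((d + 1) ^ card (insert J P))"
    using insert.hyps by (intro power_increasing) (auto simp: m_def)
  \<comment> \<open>Just large enough for the induction hypothesis, which keeps the number of slices
    small.\<close>
  then obtain A' where A': "A' \<subseteq> A" "card A' = (k + 1) ^ m" "finite A'"
    using obtain_subset_with_card_n[of "(k + 1) ^ m" A] insert.prems(8) by (metis le_trans)
  define Z where "Z = (\<Pi>\<^sub>E i\<in>D. A')"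
  have Z: "finite Z" using D A' by (auto simp: Z_def intro: finite_PiE)
  have card_Z: "card Z \<le> (k + 1) ^ (d * m)"
  proof -
    have "card Z = (k + 1) ^ (m * card D)"
      using D A' by (simp add: Z_def card_PiE power_mult)
    also have "\<dots> \<le> (k + 1) ^ (d * m)"
      using card_D by (intro power_increasing) auto
    finally show ?thesis .
  qed
  define S1 where "S1 = {s\<in>S. split_product (J \<union> D) J (T s)}"
  have S1: "S1 \<subseteq> S" "finite S1" using insert.prems by (auto simp: S1_def)
  have "card (S1 \<times> Z) < card A"
  proof -
    have "card (S1 \<times> Z) \<le> k * (k + 1) ^ (d * m)"
      unfolding card_cartesian_product
      using card_Z card_mono[OF insert.prems(4) S1(1)] insert.prems(5) by (intro mult_mono) auto
    also have "\<dots> < (k + 1) ^ (d * m + 1)" by simp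
    finally show ?thesis using card_A by linarith
  qed
  moreover have "split_product J J (\<lambda>x. T (fst sz) (override_on (snd sz) x J))"
    if "sz \<in> S1 \<times> Z" for sz
    using that split_product_slice[of J D "T (fst sz)" "snd sz"] J(3) by (auto simp: S1_def)
  \<comment> \<open>Every pair of a summand in \<open>S1\<close> and a point of \<open>Z\<close>
    counts as one split product on \<open>J\<close>, so one functional kills all slices.\<close>
  ultimately have "\<exists>\<phi>. box_functional A J \<phi> \<and>
      (\<forall>sz\<in>S1 \<times> Z. \<phi> (\<lambda>x. T (fst sz) (override_on (snd sz) x J)) = 0) \<and>
      \<phi> (diagonal J (\<lambda>_. 1)) \<noteq> 0"
    using J S1(2) Z insert.prems(7)
    by (intro annihilating_functional[where T = "\<lambda>sz x. T (fst sz) (override_on (snd sz) x J)"])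
       simp_all
  then obtain \<phi> where \<phi>: "box_functional A J \<phi>" "\<phi> (diagonal J (\<lambda>_. 1)) \<noteq> 0"
    and \<phi>_slice: "\<forall>sz\<in>S1 \<times> Z. \<phi> (\<lambda>x. T (fst sz) (override_on (snd sz) x J)) = 0"
    by blast
  \<comment> \<open>Normalized to take the value 1 on the diagonal, so that it turns
    \<open>Delta (insert J P)\<close> into \<open>Delta P\<close>.\<close>
  define \<psi> where "\<psi> a = \<phi> a / \<phi> (diagonal J (\<lambda>_. 1))" for a
  have \<psi>: "box_functional A J \<psi>"
    unfolding box_functional_def \<psi>_def
  proof (intro conjI allI impI)
    fix a b :: "(nat \<Rightarrow> nat) \<Rightarrow> 'f"
    assume "\<forall>x. (\<forall>i\<in>J. x i \<in> A) \<longrightarrow> a x = b x"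
    then have "\<phi> a = \<phi> b" by (intro box_functional_cong[OF \<phi>(1)]) blast
    then show "\<phi> a / \<phi> (diagonal J (\<lambda>_. 1)) = \<phi> b / \<phi> (diagonal J (\<lambda>_. 1))" by simp
  qed (use \<phi>(1) in \<open>simp_all add: box_functional_def add_divide_distrib\<close>)
  obtain j where j: "j \<in> J" using J by blast
  have "\<exists>J'\<in>P. split_product D J' (\<lambda>z. \<psi> (\<lambda>x. T s (override_on z x J)))"
    if s: "s \<in> S - S1" for s
  proof -
    obtain J' where J': "J' \<in> insert J P" "split_product (J \<union> D) J' (T s)"
      using insert.prems(6)[of s] s by (auto simp: D_def)
    then have "J' \<in> P" using s by (auto simp: S1_def)
    then show ?thesis
      using split_product_apply_functional[OF J'(2) _ _ J(3) j \<psi>] s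
      unfolding S1_def D_def by blast
  qed
  moreover have "card (S - S1) \<le> k"
    using insert.prems(4,5) card_mono[of S "S - S1"] by force
  ultimately obtain z where z: "\<forall>i\<in>D. z i \<in> A'"
      "Delta P z \<noteq> (\<Sum>s\<in>S-S1. \<psi> (\<lambda>x. T s (override_on z x J)))"
    using insert.IH[of "S - S1" "\<lambda>s z. \<psi> (\<lambda>x. T s (override_on z x J))" A']
      insert.prems card_D A' by (force simp: D_def m_def disjoint_def)
  show ?case
  proof (rule ccontr)
    assume "\<not> ?thesis"
    then have eq: "Delta (insert J P) x = (\<Sum>s\<in>S. T s x)" if "\<forall>i\<in>J \<union> D. x i \<in> A" for x
      using that by (auto simp: D_def)
    have zero: "\<psi> (\<lambda>x. T s (override_on z x J)) = 0" if s: "s \<in> S1" for s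
    proof -
      have "depends_on (T s) (J \<union> D)"
        using s split_product_depends_on by (auto simp: S1_def)
      \<comment> \<open>Points of \<open>Z\<close> are extensional, so \<open>z\<close> is replaced
        by its restriction to \<open>D\<close>.\<close>
      then have "T s (override_on z x J) = T s (override_on (restrict z D) x J)" for x
        by (rule depends_onD) (auto simp: override_on_def)
      moreover have "restrict z D \<in> Z" using z by (auto simp: Z_def)
      ultimately show ?thesis using bspec[OF \<phi>_slice, of "(s, restrict z D)"] s by (simp add: \<psi>_def)
    qed
    \<comment> \<open>Apply \<open>\<psi>\<close> to the slice at \<open>z\<close> of the assumed
      identity: the summands in \<open>S1\<close> vanish, which contradicts the choice of
      \<open>z\<close>.\<close>
    have "Delta P z = \<psi> (\<lambda>x. Delta P z * diagonal J (\<lambda>_. 1) x)"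
      using box_functional_scale[OF \<psi>] \<phi>(2) by (simp add: \<psi>_def)
    also have "\<dots> = \<psi> (\<lambda>x. \<Sum>s\<in>S. T s (override_on z x J))"
    proof (rule box_functional_cong[OF \<psi>])
      fix x assume "\<forall>i\<in>J. x i \<in> A"
      then have "\<forall>i\<in>J \<union> D. override_on z x J i \<in> A"
        using z A' by (auto simp: override_on_def)
      from eq[OF this] show "Delta P z * diagonal J (\<lambda>_. 1) x = (\<Sum>s\<in>S. T s (override_on z x J))"
        using Delta_insert_override_on[OF insert.hyps disj] by metis
    qed
    also have "\<dots> = (\<Sum>s\<in>S. \<psi> (\<lambda>x. T s (override_on z x J)))"
      by (rule box_functional_sum[OF \<psi>])
    also have "\<dots> = (\<Sum>s\<in>S-S1. \<psi> (\<lambda>x. T s (override_on z x J)))"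
      using insert.prems(4) zero by (intro sum.mono_neutral_right) auto
    finally show False using z by simp
  qed
qed

section \<open>Rank-one tensors, the case of one summand, and the exponent\<close>

text \<open>Some block \<open>J\<close> of \<open>P\<close> lies in no block of \<open>Q\<close>. A
  block \<open>K\<close> of \<open>Q\<close> through a point of \<open>J\<close> therefore cuts
  \<open>J\<close>, and its factor is separated from all the others.\<close>

lemma rank_one_split_product:
  fixes a :: "nat set \<Rightarrow> (nat \<Rightarrow> nat) \<Rightarrow> 'f::field"
  assumes P: "partition_on D P" and Q: "partition_on D Q" and "\<not> refines D P Q" "finite Q"
  shows "\<exists>J\<in>P. split_product D J (\<lambda>x. \<Prod>K\<in>Q. a K (restrict x K))"
proof -
  obtain J where J: "J \<in> P" "\<And>K. K \<in> Q \<Longrightarrow> \<not> J \<subseteq> K"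
    using assms unfolding refines_def by blast
  then obtain j where j: "j \<in> J" using P by (force simp: partition_on_def)
  then obtain K where K: "K \<in> Q" "j \<in> K" "K \<subseteq> D"
    using J(1) P Q unfolding partition_on_def by (metis UnionE UnionI Union_upper)
  have dep: "depends_on (\<lambda>x. a L (restrict x L)) L" for L
    unfolding depends_on_def by (intro allI impI arg_cong[where f = "a L"]) auto
  have "depends_on (\<lambda>x. \<Prod>L\<in>Q-{K}. a L (restrict x L)) (D - K)"
    unfolding depends_on_def
  proof (intro allI impI prod.cong refl)
    fix x y :: "nat \<Rightarrow> nat" and L assume xy: "\<forall>i\<in>D - K. x i = y i" and L: "L \<in> Q - {K}"
    have "L \<subseteq> D - K" using L K Q by (auto simp: partition_on_def disjoint_def)
    then show "a L (restrict x L) = a L (restrict y L)"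
      using xy by (intro depends_onD[OF dep]) auto
  qed
  moreover have "(\<lambda>x. \<Prod>L\<in>Q. a L (restrict x L)) =
      (\<lambda>x. a K (restrict x K) * (\<Prod>L\<in>Q-{K}. a L (restrict x L)))"
    using K assms(4) by (simp add: prod.remove)
  ultimately have "split_product D J (\<lambda>x. \<Prod>L\<in>Q. a L (restrict x L))"
    unfolding split_product_def using dep[of K] K j J(2)[OF K(1)]
    by (intro exI[of _ K] exI[of _ "\<lambda>x. a K (restrict x K)"]
        exI[of _ "\<lambda>x. \<Prod>L\<in>Q-{K}. a L (restrict x L)"]) auto
  then show ?thesis using J by blast
qed

text \<open>Agreement at the constant points \<open>u\<close> and \<open>v\<close>, where
  \<open>Delta P\<close> is 1, makes \<open>f\<close> and \<open>g\<close> nonzero there. At the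
  mixed point \<open>p\<close> the product is then nonzero, but \<open>J\<close> sees both values
  and \<open>Delta P\<close> vanishes.\<close>

lemma split_product_neq_Delta:
  fixes T :: "(nat \<Rightarrow> nat) \<Rightarrow> 'f::field"
  assumes "finite P" "J \<in> P" "J \<subseteq> D" "split_product D J T" "u \<in> A" "v \<in> A" "u \<noteq> v"
  shows "\<exists>x. (\<forall>i. x i \<in> A) \<and> Delta P x \<noteq> T x"
proof (rule ccontr)
  assume "\<not> ?thesis"
  then have eq: "Delta P x = T x" if "\<forall>i. x i \<in> A" for x using that by blast
  obtain I f g where I: "I \<subseteq> D" "J \<inter> I \<noteq> {}" "J - I \<noteq> {}"
    "depends_on f I" "depends_on g (D - I)" and Teq: "T = (\<lambda>x. f x * g x)"
    using assms(4) unfolding split_product_def by blast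
  define p where "p i = (if i \<in> I then u else v)" for i
  have const: "Delta P (\<lambda>_. c) = (1 :: 'f)" for c
    by (simp add: Delta_def Delta_block_def)
  have "f (\<lambda>_. u) \<noteq> 0" "g (\<lambda>_. v) \<noteq> 0"
    using eq[of "\<lambda>_. u"] eq[of "\<lambda>_. v"] assms(5,6) const by (auto simp: Teq)
  moreover have "f p = f (\<lambda>_. u)" "g p = g (\<lambda>_. v)"
    by (auto intro!: depends_onD[OF I(4)] depends_onD[OF I(5)] simp: p_def)
  moreover have "Delta_block J (restrict p J) = (0 :: 'f)"
    using I(2,3) assms(7) by (auto simp: Delta_block_def p_def)
  then have "Delta P p = (0 :: 'f)"
    using assms(1,2) unfolding Delta_def by (intro prod_zero) auto
  ultimately show False
    using eq[of p] assms(5,6) by (simp add: Teq p_def split: if_splits)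
qed

text \<open>Compares the exponent reached with the claimed one; the factor 2 pays for replacing
  \<open>k + 1\<close> by \<open>k ^ 2\<close>. Powers of 2 mediate, through
  \<open>d + 1 \<le> 2 ^ d\<close>.\<close>

lemma two_mult_Suc_power_le:
  fixes d m :: nat
  assumes "m \<le> d"
  shows "2 * (d + 1) ^ m \<le> 3 ^ (2 ^ (d + 1))"
proof -
  have sq: "1 + d * d \<le> 2 ^ (d + 1)"
  proof (cases "d \<le> 1")
    case True
    then show ?thesis by (cases d) auto
  next
    case False
    then have "2 \<le> d" by simp
    then show ?thesis
    proof (induction d rule: dec_induct)
      case (step e)
      define q where "q = e * e"
      have e: "2 * e \<le> q" unfolding q_def by (rule mult_le_mono1[OF step.hyps(1)])
      have "1 + Suc e * Suc e = 2 + 2 * e + q" by (simp add: q_def)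
      also have "\<dots> \<le> 2 * (1 + q)" using e by simp
      also have "\<dots> \<le> 2 ^ (Suc e + 1)" using step.IH by (simp add: q_def)
      finally show ?case .
    qed simp
  qed
  have "d + 1 \<le> 2 ^ d" using less_exp[of d] by (simp only: Suc_eq_plus1[symmetric] Suc_le_eq)
  then have "(d + 1) ^ m \<le> (2 ^ d) ^ m" by (rule power_mono) simp
  also have "\<dots> \<le> (2 ^ d) ^ d" using assms by (intro power_increasing) auto
  finally have "2 * (d + 1) ^ m \<le> 2 ^ (1 + d * d)" by (simp add: power_mult)
  also have "\<dots> \<le> 2 ^ (2 ^ (d + 1))" using sq by (intro power_increasing) auto
  also have "\<dots> \<le> 3 ^ (2 ^ (d + 1))" by (intro power_mono) auto
  finally show ?thesis .
qed

section \<open>From a minimal decomposition to the lower bound\<close>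

theorem theorem1p4:
  fixes d n :: nat and P :: "nat set set" and R :: "nat set set set"
  assumes "d \<ge> 2"
    and "partition_on {1..d} P"
    and "R \<noteq> {}"
    and "\<And>Q. Q \<in> R \<Longrightarrow> partition_on {1..d} Q"
    and "\<And>Q. Q \<in> R \<Longrightarrow> \<not> refines {1..d} P Q"
    and "n \<ge> 1"
  shows "real (R_rank d (\<lambda>_. n) R (Delta P :: (nat \<Rightarrow> nat) \<Rightarrow> 'f::field))
           \<ge> real n powr (3 powr (- (2 ^ (d + 1))))"
proof -
  define k where "k = R_rank d (\<lambda>_. n) R (Delta P :: (nat \<Rightarrow> nat) \<Rightarrow> 'f)"
  have fin: "finite Q" if "partition_on {1..d} Q" for Q
    using that by (meson finite_atLeastAtMost finite_elements)
  have P: "finite P" "\<Union>P = {1..d}" "disjoint P" "\<And>J. J \<in> P \<Longrightarrow> finite J \<and> J \<noteq> {}"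
    using fin[OF assms(2)] finite_subset[of _ "{1..d}"] assms(2)
    unfolding partition_on_def by (blast, blast, blast, metis Union_upper finite_atLeastAtMost)
  have card_P: "card P \<le> d"
  proof -
    have "card P = (\<Sum>J\<in>P. 1)" by simp
    also have "\<dots> \<le> (\<Sum>J\<in>P. card J)"
      using P(4) by (intro sum_mono) (simp add: Suc_le_eq card_gt_0_iff)
    also have "\<dots> = card (\<Union>P)"
      using P by (intro card_Union_disjoint[symmetric]) (auto simp: disjoint_def pairwise_def disjnt_def)
    finally show ?thesis using P(2) by simp
  qed
  have "R_decomposition d (\<lambda>_. n) R (Delta P :: (nat \<Rightarrow> nat) \<Rightarrow> 'f) k"
    unfolding k_def R_rank_def
    by (rule LeastI_ex, rule R_decomposition_exists) (use assms in auto)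
  then obtain S :: "nat \<Rightarrow> (nat \<Rightarrow> nat) \<Rightarrow> 'f" where
    S: "\<And>i. i < k \<Longrightarrow> R_rank_at_most_1 d (\<lambda>_. n) R (S i)"
      "\<And>x. x \<in> index_box d (\<lambda>_. n) \<Longrightarrow> Delta P x = (\<Sum>i<k. S i x)"
    unfolding R_decomposition_def by blast
  have "\<forall>i\<in>{..<k}. \<exists>Q a. Q \<in> R \<and> (\<forall>x\<in>index_box d (\<lambda>_. n). S i x = (\<Prod>J\<in>Q. a J (restrict x J)))"
    using S(1) unfolding R_rank_at_most_1_def by blast
  then obtain Q a where Q: "\<And>i. i < k \<Longrightarrow> Q i \<in> R"
      "\<And>i x. i < k \<Longrightarrow> x \<in> index_box d (\<lambda>_. n) \<Longrightarrow> S i x = (\<Prod>J\<in>Q i. a i J (restrict x J))"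
    by (metis lessThan_iff)
  \<comment> \<open>\<open>S i\<close> is a product on the box only; \<open>T i\<close> is given by
    the same formula everywhere, as \<open>split_product\<close> requires.\<close>
  define T where "T i x = (\<Prod>J\<in>Q i. a i J (restrict x J))" for i x
  have split: "\<exists>J\<in>P. split_product {1..d} J (T i)" if "i < k" for i
    unfolding T_def[abs_def]
    using rank_one_split_product[OF assms(2) assms(4) assms(5) fin] Q(1)[OF that] assms(4) by blast
  have restr: "restrict (restrict x {1..d}) J = restrict x J" if "partition_on {1..d} P'" "J \<in> P'"
    for x :: "nat \<Rightarrow> nat" and J P'
  proof -
    have "J \<subseteq> {1..d}" using that by (auto simp: partition_on_def)
    then show ?thesis by (simp add: Int_absorb1 Int_absorb2)
  qed
  have eq: "Delta P x = (\<Sum>i<k. T i x)" if x: "\<forall>i\<in>{1..d}. x i \<in> {1..n}" for x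
  proof -
    have x': "restrict x {1..d} \<in> index_box d (\<lambda>_. n)" using x by (auto simp: index_box_def)
    have "Delta P x = (Delta P (restrict x {1..d}) :: 'f)"
      using restr[OF assms(2)] by (simp add: Delta_def)
    also have "\<dots> = (\<Sum>i<k. T i (restrict x {1..d}))"
      using S(2)[OF x'] Q(2)[OF _ x'] by (simp add: T_def)
    also have "\<dots> = (\<Sum>i<k. T i x)"
      using restr[OF assms(4)[OF Q(1)]] by (simp add: T_def)
    finally show ?thesis .
  qed
  have upper: "n < (k + 1) ^ ((d + 1) ^ card P)"
  proof (rule ccontr)
    assume "\<not> ?thesis"
    then show False
      using Delta_neq_sum_split_products[of P d "{..<k}" k T "{1..n}"] P split eq by auto
  qed
  \<comment> \<open>For \<open>k = 1\<close> the bound \<open>upper\<close> has base 2 and cannot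
    yield \<open>n \<le> k ^ E = 1\<close>.\<close>
  have one: "n = 1" if k1: "k = 1"
  proof (rule ccontr)
    assume "n \<noteq> 1"
    moreover obtain J where J: "J \<in> P" "split_product {1..d} J (T 0)" using split[of 0] k1 by auto
    moreover have "J \<subseteq> {1..d}" using J(1) P(2) by blast
    ultimately show False
      using split_product_neq_Delta[of P J "{1..d}" "T 0" 1 "{1..n}" 2] P eq k1 assms(6) by auto
  qed
  define E where "E = (3 :: nat) ^ (2 ^ (d + 1))"
  have "n \<le> k ^ E"
  proof -
    consider "k = 0" | "k = 1" | "k \<ge> 2" by linarith
    then show ?thesis
    proof cases
      case 1
      \<comment> \<open>Here \<open>upper\<close> reads \<open>n < 1\<close>, contrary to
        \<open>n \<ge> 1\<close>.\<close>
      then show ?thesis using upper assms(6) by simp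
    next
      case 2
      then show ?thesis using one by simp
    next
      case 3
      have "k + 1 \<le> k ^ 2" using 3 mult_le_mono1[OF 3, of k] unfolding power2_eq_square by linarith
      then have "(k + 1) ^ ((d + 1) ^ card P) \<le> (k ^ 2) ^ ((d + 1) ^ card P)"
        by (rule power_mono) simp
      also have "\<dots> = k ^ (2 * (d + 1) ^ card P)" by (simp add: power_mult)
      also have "\<dots> \<le> k ^ E"
        unfolding E_def using 3 two_mult_Suc_power_le[OF card_P] by (intro power_increasing) auto
      finally show ?thesis using upper by simp
    qed
  qed
  then have "real n \<le> real k ^ E" by (metis of_nat_le_iff of_nat_power)
  moreover have "E > 0" by (simp add: E_def)
  \<comment> \<open>Positivity of \<open>k\<close> allows the passage from natural powers to
    \<open>powr\<close>.\<close>
  moreover from calculation have "k > 0"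
    using assms(6) by (intro gr0I) (simp add: zero_power)
  ultimately have k: "real n \<le> real k powr real E" "k > 0"
    by (simp_all add: powr_realpow)
  \<comment> \<open>The claimed exponent is \<open>1 / E\<close>, so it remains to take the
    \<open>E\<close>-th root of \<open>n \<le> k ^ E\<close>.\<close>
  have "3 powr (- (2 ^ (d + 1))) = inverse (real E)"
    using powr_realpow[of 3 "2 ^ (d + 1)"] by (simp add: powr_minus E_def)
  then have "real n powr (3 powr (- (2 ^ (d + 1)))) \<le> (real k powr real E) powr inverse (real E)"
    using k(1) by (simp add: powr_mono2)
  also have "\<dots> = real k" using \<open>E > 0\<close> k(2) by (simp add: powr_powr)
  finally show ?thesis by (simp add: k_def)
qed

end
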